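(* For every connected $k$-regular graph $G$, the neighborhood corona $P_3\bigstar G$ admits no perfect state transfer (between any two vertices).
   Context: All graphs are finite, simple and undirected; $P_3$ is the path on three vertices. For graphs $G_1$ (order $n_1$) and $G_2$, the neighborhood corona $G_1\bigstar G_2$ is obtained from one copy of $G_1$ and $n_1$ copies of $G_2$ by joining every neighbor (in $G_1$) of the $i$-th vertex of $G_1$ to every vertex of the $i$-th copy of $G_2$. A graph with adjacency matrix $A$ admits perfect state transfer between distinct vertices $x,y$ if $\exp(-itA)e_x=\gamma e_y$ for some $t>0$ and $|\gamma|=1$. *)

theory Defs
  imports "Graph_Theory.Graph_Theory" "HOL-Analysis.Analysis"
begin

text \<open>
  Finite simple undirected graphs are rendered by \<^locale>\<open>pair_graph\<close>: a finite vertex set with an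
  irreflexive symmetric set of ordered pairs of vertices. An edge is thus a pair of opposite arcs,
  and the degree of a vertex is its out-degree. \<^const>\<open>Digraph_Component.connected\<close> (not to be
  confused with the topological notion) excludes the empty graph.
\<close>

definition regular_graph :: "nat \<Rightarrow> 'a pair_pre_digraph \<Rightarrow> bool" where
  "regular_graph k G \<longleftrightarrow> (\<forall>v\<in>pverts G. out_degree (with_proj G) v = k)"

definition P3 :: "3 pair_pre_digraph" where
  "P3 = \<lparr>pverts = UNIV, parcs = {(0, 1), (1, 0), (1, 2), (2, 1)}\<rparr>"

text \<open>
  \<open>Inl u\<close> is the vertex \<open>u\<close> of the copy of \<open>G\<^sub>1\<close>, and \<open>Inr (u, v)\<close> is the vertex \<open>v\<close> of the
  copy of \<open>G\<^sub>2\<close> that belongs to \<open>u\<close>. That copy is joined to the neighbours \<open>w\<close> of \<open>u\<close>.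
\<close>

definition neighborhood_corona ::
    "'a pair_pre_digraph \<Rightarrow> 'b pair_pre_digraph \<Rightarrow> ('a + 'a \<times> 'b) pair_pre_digraph"
    (infixl \<open>\<bigstar>\<close> 70) where
  "G\<^sub>1 \<bigstar> G\<^sub>2 = \<lparr>
     pverts = Inl ` pverts G\<^sub>1 \<union> Inr ` (pverts G\<^sub>1 \<times> pverts G\<^sub>2),
     parcs = {(Inl u, Inl w) | u w. (u, w) \<in> parcs G\<^sub>1}
       \<union> {(Inr (u, v), Inr (u, v')) | u v v'. u \<in> pverts G\<^sub>1 \<and> (v, v') \<in> parcs G\<^sub>2}
       \<union> {(Inl w, Inr (u, v)) | u w v. (u, w) \<in> parcs G\<^sub>1 \<and> v \<in> pverts G\<^sub>2}
       \<union> {(Inr (u, v), Inl w) | u w v. (u, w) \<in> parcs G\<^sub>1 \<and> v \<in> pverts G\<^sub>2}\<rparr>"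

lemma pair_graph_P3: "pair_graph P3"
  by unfold_locales (auto simp: P3_def symmetric_def sym_def)

lemma pair_graph_neighborhood_corona:
  assumes "pair_graph G\<^sub>1" "pair_graph G\<^sub>2"
  shows "pair_graph (G\<^sub>1 \<bigstar> G\<^sub>2)"
proof -
  interpret G1: pair_graph G\<^sub>1 by fact
  interpret G2: pair_graph G\<^sub>2 by fact
  have sym1: "(v, u) \<in> parcs G\<^sub>1" if "(u, v) \<in> parcs G\<^sub>1" for u v
    using G1.pair_sym_arcs that by (auto simp: symmetric_def sym_def)
  have sym2: "(v, u) \<in> parcs G\<^sub>2" if "(u, v) \<in> parcs G\<^sub>2" for u v
    using G2.pair_sym_arcs that by (auto simp: symmetric_def sym_def)
  have fin: "finite (pverts (G\<^sub>1 \<bigstar> G\<^sub>2))"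
    by (simp add: neighborhood_corona_def)
  have sub: "parcs (G\<^sub>1 \<bigstar> G\<^sub>2) \<subseteq> pverts (G\<^sub>1 \<bigstar> G\<^sub>2) \<times> pverts (G\<^sub>1 \<bigstar> G\<^sub>2)"
    by (auto simp: neighborhood_corona_def dest: G1.in_arcsD1 G1.in_arcsD2 G2.in_arcsD1 G2.in_arcsD2)
  show ?thesis
  proof unfold_locales
    show "finite (parcs (G\<^sub>1 \<bigstar> G\<^sub>2))"
      using fin sub by (meson finite_SigmaI finite_subset)
    show "symmetric (with_proj (G\<^sub>1 \<bigstar> G\<^sub>2))"
      by (auto simp: symmetric_def sym_def neighborhood_corona_def intro: sym1 sym2)
    show "fst e \<noteq> snd e" if "e \<in> parcs (G\<^sub>1 \<bigstar> G\<^sub>2)" for e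
      using that by (auto simp: neighborhood_corona_def dest: G1.pair_no_loops G2.pair_no_loops)
  qed (use fin sub in auto)
qed

lemma pverts_P3_corona: "pverts G = UNIV \<Longrightarrow> pverts (P3 \<bigstar> G) = UNIV"
  by (auto simp: P3_def neighborhood_corona_def UNIV_sum)

text \<open>
  Multiplication, and hence the power operation, of the type class instance for vectors is
  componentwise; \<open>matrix_power\<close> is the power with respect to the matrix product.
\<close>

primrec matrix_power :: "complex^'n^'n \<Rightarrow> nat \<Rightarrow> complex^'n^'n" where
  "matrix_power A 0 = mat 1"
| "matrix_power A (Suc m) = A ** matrix_power A m"

definition matrix_exp :: "complex^'n^'n \<Rightarrow> complex^'n^'n" where
  "matrix_exp A = (\<Sum>m. matrix_power A m /\<^sub>R fact m)"

lemma summable_matrix_exp: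
  fixes A :: "complex^'n^'n"
  shows "summable (\<lambda>m. matrix_power A m /\<^sub>R fact m)"
proof -
  define M where "M = (\<Sum>i\<in>UNIV. \<Sum>j\<in>UNIV. norm (A $ i $ j))"
  have M0: "0 \<le> M"
    by (simp add: M_def sum_nonneg)
  have row: "(\<Sum>j\<in>UNIV. norm (A $ i $ j)) \<le> M" for i
    unfolding M_def by (rule member_le_sum) (auto intro: sum_nonneg)
  have entry: "norm (matrix_power A m $ i $ j) \<le> M ^ m" for m i j
  proof (induction m arbitrary: i)
    case (Suc m)
    have "norm (matrix_power A (Suc m) $ i $ j)
        \<le> (\<Sum>l\<in>UNIV. norm (A $ i $ l) * norm (matrix_power A m $ l $ j))"
      by (simp add: matrix_matrix_mult_def norm_mult[symmetric] norm_sum)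
    also have "\<dots> \<le> (\<Sum>l\<in>UNIV. norm (A $ i $ l) * M ^ m)"
      by (intro sum_mono mult_left_mono Suc.IH) auto
    also have "\<dots> \<le> M * M ^ m"
      using mult_right_mono[OF row] M0 by (simp add: sum_distrib_right[symmetric])
    finally show ?case by simp
  qed (simp add: mat_def)
  define N where "N = real CARD('n)"
  have "norm (matrix_power A m) \<le> N * (N * M ^ m)" for m
  proof -
    have "norm (matrix_power A m) \<le> (\<Sum>i\<in>UNIV. \<Sum>j\<in>UNIV. norm (matrix_power A m $ i $ j))"
      by (subst norm_vec_def, rule order_trans[OF L2_set_le_sum])
        (auto intro!: sum_mono simp: norm_vec_def intro: L2_set_le_sum)
    also have "\<dots> \<le> (\<Sum>i\<in>(UNIV::'n set). \<Sum>j\<in>(UNIV::'n set). M ^ m)"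
      by (intro sum_mono entry)
    finally show ?thesis by (simp add: N_def)
  qed
  then have "norm (matrix_power A m /\<^sub>R fact m) \<le> N * N * (M ^ m /\<^sub>R fact m)" for m
    by (simp add: field_simps)
  moreover have "summable (\<lambda>m. N * N * (M ^ m /\<^sub>R fact m))"
    by (intro summable_mult summable_exp_generic)
  ultimately show ?thesis
    by (rule summable_comparison_test'[where N = 0, rotated])
qed

text \<open>
  The adjacency matrix is indexed by the vertex type, so it is the adjacency matrix in the usual
  sense for graphs whose vertex set is the whole type.
\<close>

definition adjacency_matrix :: "'a::finite pair_pre_digraph \<Rightarrow> complex^'a^'a" where
  "adjacency_matrix G = (\<chi> x y. if (x, y) \<in> parcs G then 1 else 0)"

definition perfect_state_transfer :: "'a::finite pair_pre_digraph \<Rightarrow> 'a \<Rightarrow> 'a \<Rightarrow> bool" where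
  "perfect_state_transfer G x y \<longleftrightarrow>
     x \<in> pverts G \<and> y \<in> pverts G \<and> x \<noteq> y \<and>
     (\<exists>t::real. \<exists>\<gamma>::complex. t > 0 \<and> cmod \<gamma> = 1 \<and>
        matrix_exp (mat (- \<i> * of_real t) ** adjacency_matrix G) *v axis x 1 = \<gamma> *s axis y 1)"

end

(*
  If perfect state transfer takes x to y at time t with phase gamma, then every eigenfunction f of
  the graph, with eigenvalue theta, satisfies exp(- i t theta) f(x) = gamma f(y). For P3 corona G it
  is enough to test eigenfunctions that are constant on each copy of G. Those that are antisymmetric
  under the swap of the ends of P3 (supported on P3 for theta = 0, on the copies for theta = k), and
  those that come from the eigenvalues mu = sqrt 2 and mu = - sqrt 2 of P3, leave only pairs x, y on
  which all four eigenfunctions for mu agree, so that exp(- i t theta) = gamma for the four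
  corresponding eigenvalues. The two eigenvalues for mu have squared distance
  k^2 + 2 + 8 n - 2 mu k, hence for k > 0 a rational quotient of the two distances would make sqrt 2
  rational. For k = 0 connectedness gives n = 1; the antisymmetric eigenfunctions then force
  gamma^2 = 1, and the two eigenvalues for mu = sqrt 2, which have sum sqrt 2 and product - 2, would
  have a rational quotient, making sqrt 5 rational.
*)
theory Submission
  imports Defs
begin

section \<open>Perfect state transfer tested on eigenfunctions\<close>

lemma matrix_exp_eigenvector:
  fixes A :: "complex^'n^'n"
  assumes "f v* A = c *s f"
  shows "f v* matrix_exp A = exp c *s f"
proof -
  have "(c *s f) v* B = c *s (f v* B)" for c and B :: "complex^'n^'n"
    by (simp add: vec_eq_iff vector_matrix_mult_def sum_distrib_left mult_ac)
  then have power: "f v* matrix_power A m = c ^ m *s f" for m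
    by (induction m) (simp_all add: assms vector_matrix_mul_assoc[symmetric])
  have "linear (\<lambda>X. f v* X)"
    by (rule linearI)
      (simp_all add: vec_eq_iff vector_matrix_mult_def algebra_simps sum.distrib scaleR_sum_right)
  then have bl: "bounded_linear (\<lambda>X. f v* X)"
    by (simp add: linear_conv_bounded_linear)
  have "(\<lambda>m. f v* (matrix_power A m /\<^sub>R fact m)) sums (f v* matrix_exp A)"
    unfolding matrix_exp_def
    by (intro bounded_linear.sums[OF bl] summable_sums summable_matrix_exp)
  moreover have "f v* (matrix_power A m /\<^sub>R fact m) = (c ^ m /\<^sub>R fact m) *s f" for m
    by (simp add: linear_cmul[OF \<open>linear (\<lambda>X. f v* X)\<close>] power) (simp add: vec_eq_iff)
  ultimately have "(\<lambda>m. (c ^ m /\<^sub>R fact m) *s f) sums (f v* matrix_exp A)"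
    by simp
  moreover have "(\<lambda>m. (c ^ m /\<^sub>R fact m) *s f) sums (exp c *s f)"
  proof -
    have "linear (\<lambda>c. c *s f)"
      by (rule linearI) (simp_all add: vec_eq_iff algebra_simps)
    then have "bounded_linear (\<lambda>c. c *s f)"
      by (simp add: linear_conv_bounded_linear)
    from bounded_linear.sums[OF this exp_converges] show ?thesis .
  qed
  ultimately show ?thesis
    by (rule sums_unique2)
qed

text \<open>Summing over in-neighbours makes \<open>f\<close> a left eigenvector of the adjacency
  matrix. Real values allow cancelling phases by taking moduli.\<close>

definition eigenfunction :: "'a pair_pre_digraph \<Rightarrow> real \<Rightarrow> ('a \<Rightarrow> real) \<Rightarrow> bool" where
  "eigenfunction G \<theta> f \<longleftrightarrow> (\<forall>z. (\<Sum>w | (w, z) \<in> parcs G. f w) = \<theta> * f z)"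

text \<open>The row vector of \<open>f\<close> is multiplied by column \<open>x\<close> of the
  exponential: the eigenvector property gives one side, and the column being \<open>\<gamma>\<close>
  times the unit vector at \<open>y\<close> gives the other. One pair \<open>t\<close>,
  \<open>\<gamma>\<close> serves all eigenfunctions.\<close>

lemma perfect_state_transfer_eigenfunction:
  fixes G :: "'a::finite pair_pre_digraph"
  assumes "perfect_state_transfer G x y"
  obtains t :: real and \<gamma> :: complex
  where "t > 0" "cmod \<gamma> = 1"
    "\<And>\<theta> f. eigenfunction G \<theta> f \<Longrightarrow> cis (- (t * \<theta>)) * f x = \<gamma> * f y"
proof -
  obtain t :: real and \<gamma> :: complex where t: "t > 0" "cmod \<gamma> = 1"
    and U: "matrix_exp (mat (- \<i> * of_real t) ** adjacency_matrix G) *v axis x 1 = \<gamma> *s axis y 1"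
    using assms by (auto simp: perfect_state_transfer_def)
  define A where "A = mat (- \<i> * of_real t) ** adjacency_matrix G"
  have A: "A $ i $ j = (if (i, j) \<in> parcs G then - \<i> * t else 0)" for i j
    by (simp add: A_def matrix_matrix_mult_def mat_def adjacency_matrix_def
        if_distrib[of "\<lambda>z. z * _"] cong: if_cong)
  have U': "matrix_exp A $ i $ x = (if i = y then \<gamma> else 0)" for i
    using arg_cong[OF U[folded A_def], of "\<lambda>v. v $ i"]
    by (simp add: matrix_vector_mult_def axis_def if_distrib[of "\<lambda>z. _ * z"]
        cong: if_cong)
  have "cis (- (t * \<theta>)) * f x = \<gamma> * f y" if f: "eigenfunction G \<theta> f" for \<theta> f
  proof -
    define F :: "complex^'a" where "F = (\<chi> z. of_real (f z))"
    have "F v* A = (- \<i> * t * \<theta>) *s F"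
    proof (subst vec_eq_iff, intro allI)
      fix z
      have "(F v* A) $ z = (\<Sum>w\<in>UNIV. (if (w, z) \<in> parcs G then - \<i> * t * f w else 0))"
        by (auto simp: vector_matrix_mult_def A F_def intro!: sum.cong)
      also have "\<dots> = (\<Sum>w | (w, z) \<in> parcs G. - \<i> * t * f w)"
        by (simp add: sum.If_cases)
      also have "\<dots> = - \<i> * t * of_real (\<Sum>w | (w, z) \<in> parcs G. f w)"
        by (simp add: sum_distrib_left)
      finally show "(F v* A) $ z = ((- \<i> * t * \<theta>) *s F) $ z"
        using f by (simp add: eigenfunction_def F_def del: of_real_sum)
    qed
    from arg_cong[OF matrix_exp_eigenvector[OF this], of "\<lambda>v. v $ x"]
    have "\<gamma> * f y = exp (- \<i> * t * \<theta>) * f x"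
      by (simp add: vector_matrix_mult_def U' F_def if_distrib[of "\<lambda>z. _ * z"] mult.commute
          cong: if_cong)
    then show ?thesis
      by (simp add: cis_conv_exp mult_ac)
  qed
  with t that show thesis
    by blast
qed

section \<open>Eigenfunctions of the corona that are constant on each copy\<close>

lemma eigenfunction_corona:
  fixes G\<^sub>1 :: "'a::finite pair_pre_digraph" and G\<^sub>2 :: "'b::finite pair_pre_digraph"
    and a b :: "'a \<Rightarrow> real"
  assumes G1: "pair_graph G\<^sub>1" "pverts G\<^sub>1 = UNIV" and G2: "pair_graph G\<^sub>2" "pverts G\<^sub>2 = UNIV"
    and reg: "regular_graph k G\<^sub>2"
    and a: "\<And>u. (\<Sum>w | (w, u) \<in> parcs G\<^sub>1. a w + CARD('b) * b w) = \<theta> * a u"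
    and b: "\<And>u. (\<Sum>w | (w, u) \<in> parcs G\<^sub>1. a w) + k * b u = \<theta> * b u"
  shows "eigenfunction (G\<^sub>1 \<bigstar> G\<^sub>2) \<theta> (case_sum a (b \<circ> fst))"
  unfolding eigenfunction_def
proof
  fix z :: "'a + 'a \<times> 'b"
  interpret G1: pair_graph G\<^sub>1 by fact
  interpret G2: pair_graph G\<^sub>2 by fact
  have sym1: "(u, v) \<in> parcs G\<^sub>1 \<longleftrightarrow> (v, u) \<in> parcs G\<^sub>1" for u v
    using G1.pair_sym_arcs by (auto simp: symmetric_def sym_def)
  have sym2: "(u, v) \<in> parcs G\<^sub>2 \<longleftrightarrow> (v, u) \<in> parcs G\<^sub>2" for u v
    using G2.pair_sym_arcs by (auto simp: symmetric_def sym_def)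
  show "(\<Sum>w | (w, z) \<in> parcs (G\<^sub>1 \<bigstar> G\<^sub>2). case_sum a (b \<circ> fst) w) = \<theta> * case_sum a (b \<circ> fst) z"
  proof (cases z)
    case (Inl u)
    have "{w. (w, z) \<in> parcs (G\<^sub>1 \<bigstar> G\<^sub>2)}
        = {w. (w, u) \<in> parcs G\<^sub>1} <+> {w. (w, u) \<in> parcs G\<^sub>1} \<times> UNIV"
      by (auto simp: Inl neighborhood_corona_def G2)
    moreover have "(\<Sum>p\<in>{w. (w, u) \<in> parcs G\<^sub>1} \<times> (UNIV::'b set). b (fst p))
        = (\<Sum>w | (w, u) \<in> parcs G\<^sub>1. CARD('b) * b w)"
      by (simp add: sum.cartesian_product')
    ultimately show ?thesis
      using a[of u]
      by (simp add: Inl sum.Plus comp_def sum.distrib)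
  next
    case (Inr p)
    obtain u v where p: "p = (u, v)" by (cases p)
    \<comment> \<open>Degrees count outgoing arcs, eigenfunctions sum over incoming ones; symmetry
      identifies the two.\<close>
    have "out_arcs (with_proj G\<^sub>2) v = Pair v ` {w. (w, v) \<in> parcs G\<^sub>2}"
      using sym2 by (auto simp: out_arcs_def)
    moreover have "card (out_arcs (with_proj G\<^sub>2) v) = k"
      using reg by (simp add: regular_graph_def out_degree_def G2)
    ultimately have "card {w. (w, v) \<in> parcs G\<^sub>2} = k"
      by (simp add: card_image inj_on_def)
    moreover have "{w. (w, z) \<in> parcs (G\<^sub>1 \<bigstar> G\<^sub>2)}
        = {w. (w, u) \<in> parcs G\<^sub>1} <+> Pair u ` {w. (w, v) \<in> parcs G\<^sub>2}"
      using sym1 by (auto simp: Inr p neighborhood_corona_def G1 G2)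
    ultimately show ?thesis
      using b[of u]
      by (simp add: Inr p sum.Plus sum.reindex inj_on_def)
  qed
qed

lemma eigenfunction_P3_corona:
  fixes G :: "'v::finite pair_pre_digraph" and a b :: "3 \<Rightarrow> real"
  assumes G: "pair_graph G" "pverts G = UNIV" and reg: "regular_graph k G"
    and a: "a 1 + CARD('v) * b 1 = \<theta> * a 0"
      "a 0 + a 2 + CARD('v) * (b 0 + b 2) = \<theta> * a 1"
      "a 1 + CARD('v) * b 1 = \<theta> * a 2"
    and b: "a 1 + k * b 0 = \<theta> * b 0" "a 0 + a 2 + k * b 1 = \<theta> * b 1"
      "a 1 + k * b 2 = \<theta> * b 2"
  shows "eigenfunction (P3 \<bigstar> G) \<theta> (case_sum a (b \<circ> fst))"
proof -
  have 3: "u = 0 \<or> u = 1 \<or> u = 2" for u :: 3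
    using exhaust_3[of u] by auto
  have nb: "{w. (w, u) \<in> parcs P3} = (if u = 1 then {0, 2} else {1})" for u
    using 3[of u] by (auto simp: P3_def)
  have P3: "pverts P3 = UNIV"
    by (simp add: P3_def)
  show ?thesis
  proof (rule eigenfunction_corona[OF pair_graph_P3 P3 G reg])
    show "(\<Sum>w | (w, u) \<in> parcs P3. a w + CARD('v) * b w) = \<theta> * a u" for u
      using a 3[of u] by (auto simp: nb algebra_simps)
    show "(\<Sum>w | (w, u) \<in> parcs P3. a w) + k * b u = \<theta> * b u" for u
      using b 3[of u] by (auto simp: nb)
  qed
qed

section \<open>Arithmetic of the eigenvalues\<close>

text \<open>For nonzero \<open>b\<close> the multiplicity of \<open>p\<close> would be even on the
  left and odd on the right. This replaces the irrationality of the square roots of 2 and 5.\<close>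

lemma square_eq_prime_times_square:
  fixes a b p :: int
  assumes "prime p" "a\<^sup>2 = p * b\<^sup>2"
  shows "b = 0"
proof (rule ccontr)
  assume b: "b \<noteq> 0"
  with assms have a: "a \<noteq> 0"
    by auto
  have "multiplicity p (a\<^sup>2) = 2 * multiplicity p a"
    using assms(1) a by (intro prime_elem_multiplicity_power_distrib) auto
  moreover have "multiplicity p (p * b\<^sup>2) = Suc (2 * multiplicity p b)"
    using assms(1) b
    by (subst multiplicity_times_same) (auto intro: prime_elem_multiplicity_power_distrib)
  ultimately have "2 * multiplicity p a = Suc (2 * multiplicity p b)"
    using assms(2) by simp
  then show False
    by presburger
qed

lemma cis_eq_imp:
  assumes "cis \<alpha> = cis \<beta>"
  obtains m :: int where "\<alpha> - \<beta> = 2 * pi * m"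
proof -
  have "cis (\<alpha> - \<beta>) = 1"
    using assms by (simp add: cis_divide[symmetric])
  then have "exp (\<i> * (\<alpha> - \<beta>)) = 1"
    by (simp add: cis_conv_exp)
  then show thesis
    using that by (auto simp: exp_eq_1)
qed

text \<open>
  These are the two eigenvalues (\<open>s = \<plusminus>1\<close>) of the corona that belong to the eigenvalue
  \<open>\<mu> = \<plusminus>\<surd>2\<close> of \<open>P\<^sub>3\<close> when \<open>G\<close> is \<open>k\<close>-regular with \<open>n\<close> vertices.
\<close>

definition corona_eigenvalue :: "nat \<Rightarrow> nat \<Rightarrow> real \<Rightarrow> real \<Rightarrow> real" where
  "corona_eigenvalue n k \<mu> s = (k + \<mu> + s * sqrt ((k - \<mu>)\<^sup>2 + 8 * n)) / 2"

text \<open>This is the characteristic equation: with values \<open>\<alpha> * p\<close> on the base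
  and \<open>\<beta> * p\<close> on the copies, where \<open>p\<close> is an eigenvector of
  \<open>P3\<close> for \<open>\<mu>\<close>, the conditions are
  \<open>(\<theta> - \<mu>) * \<alpha> = n * \<mu> * \<beta>\<close> and
  \<open>(\<theta> - k) * \<beta> = \<mu> * \<alpha>\<close>.\<close>

lemma corona_eigenvalue_root:
  assumes "\<mu>\<^sup>2 = 2" "s\<^sup>2 = 1"
  shows "(corona_eigenvalue n k \<mu> s - \<mu>) * (corona_eigenvalue n k \<mu> s - k) = 2 * n"
proof -
  have "(corona_eigenvalue n k \<mu> s - \<mu>) * (corona_eigenvalue n k \<mu> s - k)
      = (s\<^sup>2 * (sqrt ((k - \<mu>)\<^sup>2 + 8 * n))\<^sup>2 - (k - \<mu>)\<^sup>2) / 4"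
    unfolding corona_eigenvalue_def by (simp add: field_simps power2_eq_square)
  then show ?thesis
    by (simp add: assms)
qed

lemma cis_corona_eigenvalue_not_all_equal:
  assumes t: "t \<noteq> 0" and k: "k > 0"
    and eq: "\<And>\<mu>. \<mu>\<^sup>2 = 2 \<Longrightarrow> cis (t * corona_eigenvalue n k \<mu> 1) = cis (t * corona_eigenvalue n k \<mu> (- 1))"
  shows False
proof -
  define N where "N = int (k\<^sup>2 + 2 + 8 * n)"
  have *: "\<exists>m::int. t\<^sup>2 * (N - 2 * \<mu> * k) = (2 * pi)\<^sup>2 * m\<^sup>2" if \<mu>: "\<mu>\<^sup>2 = 2" for \<mu> :: real
  proof -
    obtain m :: int where "t * corona_eigenvalue n k \<mu> 1 - t * corona_eigenvalue n k \<mu> (- 1) = 2 * pi * m"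
      using cis_eq_imp[OF eq[OF \<mu>]] .
    then have "t * sqrt ((k - \<mu>)\<^sup>2 + 8 * n) = 2 * pi * m"
      by (simp add: corona_eigenvalue_def field_simps)
    from arg_cong[OF this, of "\<lambda>x. x\<^sup>2"]
    have "t\<^sup>2 * ((k - \<mu>)\<^sup>2 + 8 * n) = (2 * pi)\<^sup>2 * m\<^sup>2"
      by (simp add: power_mult_distrib)
    moreover have "(k - \<mu>)\<^sup>2 + 8 * n = N - 2 * \<mu> * k"
      using \<mu> by (simp add: N_def power2_diff)
    ultimately show ?thesis
      by (metis of_int_power)
  qed
  obtain a b :: int where a: "t\<^sup>2 * (N - 2 * sqrt 2 * k) = (2 * pi)\<^sup>2 * a\<^sup>2"
    and b: "t\<^sup>2 * (N - 2 * - sqrt 2 * k) = (2 * pi)\<^sup>2 * b\<^sup>2"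
    using *[of "sqrt 2"] *[of "- sqrt 2"] by auto
  define d where "d = 2 * int k * (a\<^sup>2 + b\<^sup>2)"
  have "t\<^sup>2 * (2 * N) = (2 * pi)\<^sup>2 * (a\<^sup>2 + b\<^sup>2)"
    using a b by (simp add: algebra_simps)
  moreover have "t\<^sup>2 * (4 * sqrt 2 * k) = (2 * pi)\<^sup>2 * (b\<^sup>2 - a\<^sup>2)"
    using a b by (simp add: algebra_simps)
  \<comment> \<open>Cross-multiplying the sum and the difference of \<open>a\<close> and
    \<open>b\<close> eliminates \<open>t\<close> and \<open>pi\<close>.\<close>
  ultimately have "(2 * pi)\<^sup>2 * (t\<^sup>2 * 2) * (N * (b\<^sup>2 - a\<^sup>2)) = (2 * pi)\<^sup>2 * (t\<^sup>2 * 2) * (sqrt 2 * d)"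
    unfolding d_def by (simp) algebra
  then have "N * (b\<^sup>2 - a\<^sup>2) = sqrt 2 * d"
    using t by simp
  from arg_cong[OF this, of "\<lambda>x. x\<^sup>2"]
  have "of_int ((N * (b\<^sup>2 - a\<^sup>2))\<^sup>2) = (of_int (2 * d\<^sup>2) :: real)"
    by (simp add: power_mult_distrib)
  then have "(N * (b\<^sup>2 - a\<^sup>2))\<^sup>2 = 2 * d\<^sup>2"
    by linarith
  then have "d = 0"
    by (rule square_eq_prime_times_square[rotated]) simp
  then have "b = 0"
    using k by (auto simp: d_def sum_power2_eq_zero_iff)
  then have "N + 2 * sqrt 2 * k = 0"
    using b t by simp
  moreover have "N + 2 * sqrt 2 * k > 0"
    by (simp add: N_def add_pos_nonneg)
  ultimately show False
    by simp
qed

text \<open>Completing the square in \<open>a\<^sup>2 + 3 * a * b + b\<^sup>2 = 0\<close> produces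
  the discriminant 5.\<close>

lemma square_plus_product_eq_zero:
  fixes a b :: int
  assumes "(a + b)\<^sup>2 = - (a * b)"
  shows "b = 0"
proof -
  have "(2 * a + 3 * b)\<^sup>2 = 5 * b\<^sup>2"
    using assms by algebra
  moreover have "prime (5::int)"
    by simp
  ultimately show ?thesis
    by (rule square_eq_prime_times_square[rotated])
qed

lemma cis_corona_eigenvalue_single_vertex_not_sign:
  assumes t: "t \<noteq> 0" and sign: "\<And>s. s\<^sup>2 = 1 \<Longrightarrow> cis (t * corona_eigenvalue 1 0 (sqrt 2) s) \<in> {1, - 1}"
  shows False
proof -
  have *: "\<exists>m::int. t * corona_eigenvalue 1 0 (sqrt 2) s = pi * m" if "s\<^sup>2 = 1" for s
  proof -
    have "cis (2 * (t * corona_eigenvalue 1 0 (sqrt 2) s)) = cis 0"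
      using sign[OF that] cis_mult[of "t * corona_eigenvalue 1 0 (sqrt 2) s" "t * corona_eigenvalue 1 0 (sqrt 2) s"]
      by (auto simp flip: mult_2)
    then obtain m :: int where "2 * (t * corona_eigenvalue 1 0 (sqrt 2) s) - 0 = 2 * pi * m"
      by (rule cis_eq_imp)
    then show ?thesis
      by (auto intro: exI[of _ m])
  qed
  obtain a b :: int where a: "t * corona_eigenvalue 1 0 (sqrt 2) 1 = pi * a"
    and b: "t * corona_eigenvalue 1 0 (sqrt 2) (- 1) = pi * b"
    using *[of 1] *[of "- 1"] by auto
  \<comment> \<open>The relation is homogeneous of degree two, so it survives scaling by
    \<open>t\<close> and then by \<open>1 / pi\<close>, passing to the integers \<open>a\<close> and
    \<open>b\<close>.\<close>
  have "(corona_eigenvalue 1 0 (sqrt 2) 1 + corona_eigenvalue 1 0 (sqrt 2) (- 1))\<^sup>2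
      = - (corona_eigenvalue 1 0 (sqrt 2) 1 * corona_eigenvalue 1 0 (sqrt 2) (- 1))"
    by (simp add: corona_eigenvalue_def power2_eq_square field_simps flip: real_sqrt_mult)
  then have "(t * corona_eigenvalue 1 0 (sqrt 2) 1 + t * corona_eigenvalue 1 0 (sqrt 2) (- 1))\<^sup>2
      = - ((t * corona_eigenvalue 1 0 (sqrt 2) 1) * (t * corona_eigenvalue 1 0 (sqrt 2) (- 1)))"
    by algebra
  then have "pi\<^sup>2 * of_int ((a + b)\<^sup>2) = pi\<^sup>2 * of_int (- (a * b))"
    unfolding a b by (simp add: power2_eq_square algebra_simps)
  then have "of_int ((a + b)\<^sup>2) = (of_int (- (a * b)) :: real)"
    by (subst (asm) mult_left_cancel) simp_all
  then have "(a + b)\<^sup>2 = - (a * b)"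
    by linarith
  then have "b = 0"
    by (rule square_plus_product_eq_zero)
  then have "corona_eigenvalue 1 0 (sqrt 2) (- 1) = 0"
    using b t by simp
  with corona_eigenvalue_root[of "sqrt 2" "- 1" 1 0] show False
    by simp
qed

lemma connected_zero_regular:
  fixes G :: "'v::finite pair_pre_digraph"
  assumes G: "pair_graph G" "pverts G = UNIV" and conn: "Digraph_Component.connected (with_proj G)"
    and reg: "regular_graph 0 G"
  shows "x = (y::'v)"
proof -
  interpret pair_graph G by fact
  have "out_arcs (with_proj G) v = {}" for v
    using reg finite_out_arcs[of v] by (simp add: regular_graph_def out_degree_def G)
  then have "parcs G = {}"
    by (fastforce simp: out_arcs_def)
  moreover have "strongly_connected (with_proj G)"
    using conn symmetric_connected_imp_strongly_connected sym_arcs by blast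
  then have "x \<rightarrow>\<^sup>*\<^bsub>with_proj G\<^esub> y"
    by (auto simp: strongly_connected_def G)
  ultimately show ?thesis
    by (auto simp: reachable_def arcs_ends_def elim: rtrancl_on.cases)
qed

text \<open>Writing \<open>\<theta> - sqrt 2\<close> as \<open>(\<theta> - k) + (k - sqrt 2)\<close>
  in the root equation makes \<open>(\<theta> - k) * (k - sqrt 2)\<close> the same for both signs
  \<open>s\<close>. The two eigenvalues differ, so \<open>k\<close> would be
  \<open>sqrt 2\<close>.\<close>

lemma corona_eigenvalue_distance_not_sqrt2:
  assumes n: "n > 0"
    and eq: "\<And>s. s\<^sup>2 = 1 \<Longrightarrow> (corona_eigenvalue n k (sqrt 2) s - k)\<^sup>2 = 2"
  shows False
proof -
  have *: "(corona_eigenvalue n k (sqrt 2) s - k) * (k - sqrt 2) = 2 * real n - 2" if "s\<^sup>2 = 1" for s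
    using corona_eigenvalue_root[OF _ that, of "sqrt 2" n k] eq[OF that]
    by (simp add: algebra_simps power2_eq_square)
  have "sqrt ((k - sqrt 2)\<^sup>2 + 8 * n) * (k - sqrt 2)
      = (corona_eigenvalue n k (sqrt 2) 1 - corona_eigenvalue n k (sqrt 2) (- 1)) * (k - sqrt 2)"
    by (simp add: corona_eigenvalue_def field_simps)
  also have "\<dots> = 0"
    using *[of 1] *[of "- 1"] by (simp add: algebra_simps)
  finally have "k = sqrt 2"
    using n by (auto simp: add_nonneg_eq_0_iff)
  from arg_cong[OF this, of "\<lambda>x. x\<^sup>2"] have "real (k\<^sup>2) = real 2"
    by simp
  then have "k\<^sup>2 = 2"
    by linarith
  then have "(int k)\<^sup>2 = 2 * 1\<^sup>2"
    by (metis mult.right_neutral of_nat_numeral of_nat_power one_power2)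
  from square_eq_prime_times_square[OF _ this] show False
    by simp
qed

section \<open>Excluding every pair of vertices\<close>

theorem theorem4p6:
  fixes G :: "'v::finite pair_pre_digraph" and k :: nat
  assumes "pair_graph G"
    and "pverts G = UNIV"
    and "Digraph_Component.connected (with_proj G)"
    and "regular_graph k G"
  shows "\<not> (\<exists>x y. perfect_state_transfer (P3 \<bigstar> G) x y)"
proof
  assume "\<exists>x y. perfect_state_transfer (P3 \<bigstar> G) x y"
  then obtain x y where pst: "perfect_state_transfer (P3 \<bigstar> G) x y"
    by blast
  then have "x \<noteq> y"
    by (simp add: perfect_state_transfer_def)
  obtain t \<gamma> where t: "t > 0" and \<gamma>: "cmod \<gamma> = 1"
    and ev: "\<And>\<theta> f. eigenfunction (P3 \<bigstar> G) \<theta> f \<Longrightarrow> cis (- (t * \<theta>)) * f x = \<gamma> * f y"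
    by (rule perfect_state_transfer_eigenfunction[OF pst]) blast
  have abs: "\<bar>f x\<bar> = \<bar>f y\<bar>" if "eigenfunction (P3 \<bigstar> G) \<theta> f" for \<theta> f
    using arg_cong[OF ev[OF that], of cmod] by (simp add: norm_mult \<gamma>)
  have 3: "u = 0 \<or> u = 1 \<or> u = 2" for u :: 3
    using exhaust_3[of u] by auto
  note ef = eigenfunction_P3_corona[OF assms(1,2,4)]
  define n where "n = CARD('v)"
  have n: "n > 0"
    by (simp add: n_def)
  define \<theta> where "\<theta> = corona_eigenvalue n k"
  have root: "(\<theta> \<mu> s - \<mu>) * (\<theta> \<mu> s - k) = 2 * n" if "\<mu>\<^sup>2 = 2" "s\<^sup>2 = 1" for \<mu> s
    using corona_eigenvalue_root[OF that] by (simp add: \<theta>_def)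

  \<comment> \<open>\<open>d\<close> spans the kernel of the adjacency matrix of \<open>P3\<close>,
    so placing it on the base or on the copies leaves the two levels uncoupled.\<close>
  define d :: "3 \<Rightarrow> real" where "d u = (if u = 0 then 1 else if u = 2 then - 1 else 0)" for u
  define d1 :: "3 + 3 \<times> 'v \<Rightarrow> real" where "d1 = case_sum d ((\<lambda>_. 0) \<circ> fst)"
  define d2 :: "3 + 3 \<times> 'v \<Rightarrow> real" where "d2 = case_sum (\<lambda>_. 0) (d \<circ> fst)"
  have d1: "eigenfunction (P3 \<bigstar> G) 0 d1" and d2: "eigenfunction (P3 \<bigstar> G) k d2"
    unfolding d1_def d2_def by (rule ef; simp add: d_def)+
  \<comment> \<open>The vector \<open>(1, \<mu>, 1)\<close> is the eigenvector of \<open>P3\<close>;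
    the weights \<open>\<theta> - k\<close> and \<open>\<mu>\<close> in \<open>f\<close> solve the
    equation on the copies.\<close>
  define p :: "real \<Rightarrow> 3 \<Rightarrow> real" where "p \<mu> u = (if u = 1 then \<mu> else 1)" for \<mu> u
  define f :: "real \<Rightarrow> real \<Rightarrow> 3 + 3 \<times> 'v \<Rightarrow> real" where
    "f \<mu> s = case_sum (\<lambda>u. (\<theta> \<mu> s - k) * p \<mu> u) ((\<lambda>u. \<mu> * p \<mu> u) \<circ> fst)" for \<mu> s
  have f: "eigenfunction (P3 \<bigstar> G) (\<theta> \<mu> s) (f \<mu> s)" if "\<mu>\<^sup>2 = 2" "s\<^sup>2 = 1" for \<mu> s
  proof -
    have \<mu>: "\<mu> * (\<mu> * z) = 2 * z" for z
      using that by (simp add: power2_eq_square flip: mult.assoc)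
    have r: "\<theta> \<mu> s * \<theta> \<mu> s = 2 * n + \<theta> \<mu> s * k + \<mu> * \<theta> \<mu> s - \<mu> * k"
      using root[OF that] by (simp add: algebra_simps)
    moreover have "\<theta> \<mu> s * (\<theta> \<mu> s * \<mu>) = 2 * n * \<mu> + \<theta> \<mu> s * k * \<mu> + 2 * \<theta> \<mu> s - 2 * k"
      using arg_cong[OF r, of "\<lambda>x. x * \<mu>"] \<mu> by (simp add: algebra_simps)
    ultimately show ?thesis
      unfolding f_def using \<mu> \<mu>[of 1]
      by (intro ef) (simp_all add: p_def n_def[symmetric] algebra_simps)
  qed

  \<comment> \<open>The one pair that \<open>d1\<close> and \<open>d2\<close> cannot separate by
    moduli although \<open>f\<close> may differ on it: the middle vertex and a vertex of its
    copy.\<close>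
  have not_both: False
    if eq: "\<And>s. s\<^sup>2 = 1 \<Longrightarrow> \<bar>f (sqrt 2) s (Inl 1)\<bar> = \<bar>f (sqrt 2) s (Inr (1, v))\<bar>" for v
  proof (rule corona_eigenvalue_distance_not_sqrt2[OF n])
    fix s :: real
    assume "s\<^sup>2 = 1"
    from eq[OF this] have "\<bar>\<theta> (sqrt 2) s - k\<bar> * sqrt 2 = 2"
      by (simp add: f_def p_def abs_mult)
    from arg_cong[OF this, of "\<lambda>x. x\<^sup>2"] show "(corona_eigenvalue n k (sqrt 2) s - k)\<^sup>2 = 2"
      by (simp add: power_mult_distrib \<theta>_def)
  qed
  have abs1: "\<bar>d1 x\<bar> = \<bar>d1 y\<bar>" and abs2: "\<bar>d2 x\<bar> = \<bar>d2 y\<bar>"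
    using abs[OF d1] abs[OF d2] .
  have same: "f \<mu> s x = f \<mu> s y" for \<mu> s
  proof (cases x)
    case x: (Inl u)
    show ?thesis
    proof (cases y)
      case (Inl w)
      then show ?thesis
        using abs1 x 3[of u] 3[of w] by (auto simp: d1_def d_def f_def p_def)
    next
      case (Inr q)
      then have "u = 1" "fst q = 1"
        using abs1 abs2 x 3[of u] 3[of "fst q"] by (auto simp: d1_def d2_def d_def)
      then show ?thesis
        using not_both[of "snd q"] abs[OF f[of "sqrt 2"]] x Inr by (cases q) auto
    qed
  next
    case x: (Inr r)
    show ?thesis
    proof (cases y)
      case (Inl w)
      then have "w = 1" "fst r = 1"
        using abs1 abs2 x 3[of w] 3[of "fst r"] by (auto simp: d1_def d2_def d_def)
      then show ?thesis
        using not_both[of "snd r"] abs[OF f[of "sqrt 2"]] x Inl by (cases r) auto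
    next
      case (Inr q)
      then show ?thesis
        using abs2 x 3[of "fst r"] 3[of "fst q"] by (auto simp: d2_def d_def f_def p_def)
    qed
  qed
  \<comment> \<open>The root equation has a positive right side, so \<open>f\<close> vanishes
    nowhere and can be cancelled.\<close>
  have cis: "cis (- t * \<theta> \<mu> s) = \<gamma>" if "\<mu>\<^sup>2 = 2" "s\<^sup>2 = 1" for \<mu> s
  proof -
    have "\<mu> \<noteq> 0" "\<theta> \<mu> s - k \<noteq> 0"
      using root[OF that] that n by auto
    then have "f \<mu> s y \<noteq> 0"
      by (auto simp: f_def p_def split: sum.split)
    then show ?thesis
      using ev[OF f[OF that]] by (simp add: same)
  qed
  show False
  proof (cases "k = 0")
    case False
    then show False
      using cis_corona_eigenvalue_not_all_equal[of "- t" k n] t cis by (simp add: \<theta>_def)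
  next
    case True
    then have one: "v = w" for v w :: 'v
      using connected_zero_regular[of G v w] assms by simp
    then have "n = 1"
      unfolding n_def by (metis (full_types) card_1_singleton_iff UNIV_eq_I insert_iff One_nat_def)
    \<comment> \<open>With a single vertex in \<open>G\<close>, \<open>undefined\<close> denotes
      that vertex, so only two vertices lie in the common zero set of \<open>d1\<close> and
      \<open>d2\<close>.\<close>
    have middle: "z \<in> {Inl 1, Inr (1, undefined)}" if "d1 z = 0" "d2 z = 0" for z
    proof (cases z)
      case (Inl u)
      then show ?thesis
        using that 3[of u] by (auto simp: d1_def d_def)
    next
      case (Inr q)
      then show ?thesis
        using that 3[of "fst q"] one[of "snd q" undefined] by (cases q) (auto simp: d2_def d_def)
    qed
    have "d1 y \<noteq> 0 \<or> d2 y \<noteq> 0"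
    proof (rule ccontr)
      assume "\<not> ?thesis"
      then have "x \<in> {Inl 1, Inr (1, undefined)}" "y \<in> {Inl 1, Inr (1, undefined)}"
        using abs1 abs2 by (intro middle; simp)+
      then show False
        using not_both[of undefined] abs[OF f[of "sqrt 2"]] \<open>x \<noteq> y\<close> by auto
    qed
    \<comment> \<open>For \<open>k = 0\<close> both eigenvalues are 0, so the time-dependent phase
      is 1 and \<open>\<gamma>\<close> is a quotient of real numbers of equal modulus.\<close>
    moreover have "d1 x = \<gamma> * d1 y" "d2 x = \<gamma> * d2 y"
      using ev[OF d1] ev[OF d2] \<open>k = 0\<close> by simp_all
    moreover have "\<gamma> \<in> {1, - 1}"
      if "complex_of_real r = \<gamma> * complex_of_real q" "\<bar>r\<bar> = \<bar>q\<bar>" "q \<noteq> 0" for r q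
    proof -
      have "\<gamma> = of_real (r / q)"
        using that(1,3) by (simp add: field_simps)
      moreover have "r / q = 1 \<or> r / q = - 1"
        using that(2,3) by (auto simp: abs_eq_iff)
      ultimately show ?thesis
        by (auto simp del: of_real_divide)
    qed
    ultimately have "\<gamma> \<in> {1, - 1}"
      using abs1 abs2 by blast
    then show False
      using cis_corona_eigenvalue_single_vertex_not_sign[of "- t"] t cis[of "sqrt 2"]
      by (auto simp: \<theta>_def \<open>k = 0\<close> \<open>n = 1\<close>)
  qed
qed

end
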